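(* Let $d\ge 1$ and let $F\colon\Omega\to\Omega$ be a piecewise translation in $\mathbb{R}^d$ with $m=d+1$ branches, with translation vectors $v_0,\dots,v_d$ such that $v_1-v_0,\dots,v_d-v_0$ are linearly independent over $\mathbb{R}$. If the torus rotation $R\colon\mathbb{T}\to\mathbb{T}$ is ergodic (with respect to Haar measure), then $F$ is finite type, i.e. there is $n\in\mathbb{N}$ with $\Omega_n=\Omega_{n+1}$ (and hence $\Omega_k=A$ for all $k\ge n$).
   Context: A region is a compact subset of $\mathbb{R}^d$ which equals the closure of its interior. A piecewise translation with $m$ branches is defined as follows: $\Omega\subset\mathbb{R}^d$ is a region, $\Omega=P_0\cup\dots\cup P_{m-1}$ where each $P_i$ is a region, distinct $P_i$ intersect only in their boundaries, and $\mathrm{Leb}(\partial P_i)=0$ for all $i$. Vectors $v_0,\dots,v_{m-1}\in\mathbb{R}^d$ satisfy $x+v_i\in\Omega$ for all $x\in P_i$. For $x\in\Omega$, $i(x)$ denotes an index with $x\in P_{i(x)}$, the ambiguity on overlapping boundaries being resolved by a fixed rule so that $i$ is measurable; $v(x)=v_{i(x)}$ and $F(x)=x+v(x)$. Set $\Omega_0=\Omega$ and $\Omega_n=\overline{F(\Omega_{n-1})}$ for $n\ge1$; the attractor is $A=\bigcap_{n\ge0}\Omega_n$. $F$ is finite type if $\Omega_n=\Omega_{n+1}$ for some $n$. When $m=d+1$ and $v_1-v_0,\dots,v_d-v_0$ are linearly independent, $\mathcal{L}$ denotes the lattice generated by $v_1-v_0,\dots,v_d-v_0$, $\mathbb{T}=\mathbb{R}^d/\mathcal{L}$,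 $\pi\colon\mathbb{R}^d\to\mathbb{T}$ the canonical projection, and $R\colon\mathbb{T}\to\mathbb{T}$, $R(\phi)=\phi+\pi(v_0)$; then $R\circ\pi=\pi\circ F$. *)

theory Defs
  imports "HOL-Analysis.Analysis"
begin

definition region :: "'a::euclidean_space set \<Rightarrow> bool" where
  "region S \<longleftrightarrow> compact S \<and> closure (interior S) = S"

text \<open>Piecewise translation in the Euclidean space 'a with m branches indexed 0..m-1:
  domain Om, pieces P i, vectors v i, and a (measurable) index-choice function idx
  resolving ambiguities on overlapping boundaries.\<close>
definition piecewise_translation ::
  "nat \<Rightarrow> 'a::euclidean_space set \<Rightarrow> (nat \<Rightarrow> 'a set) \<Rightarrow> (nat \<Rightarrow> 'a) \<Rightarrow> ('a \<Rightarrow> nat) \<Rightarrow> bool" where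
  "piecewise_translation m Om P v idx \<longleftrightarrow>
     region Om \<and>
     Om = (\<Union>i<m. P i) \<and>
     (\<forall>i<m. region (P i)) \<and>
     (\<forall>i<m. \<forall>j<m. i \<noteq> j \<longrightarrow> P i \<inter> P j \<subseteq> frontier (P i) \<inter> frontier (P j)) \<and>
     (\<forall>i<m. frontier (P i) \<in> null_sets lebesgue) \<and>
     (\<forall>i<m. \<forall>x\<in>P i. x + v i \<in> Om) \<and>
     (\<forall>x\<in>Om. idx x < m \<and> x \<in> P (idx x)) \<and>
     (\<forall>i. {x\<in>Om. idx x = i} \<in> sets lebesgue)"

definition pt_map :: "(nat \<Rightarrow> 'a::euclidean_space) \<Rightarrow> ('a \<Rightarrow> nat) \<Rightarrow> 'a \<Rightarrow> 'a" where
  "pt_map v idx x = x + v (idx x)"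

primrec Omega_seq :: "('a::euclidean_space \<Rightarrow> 'a) \<Rightarrow> 'a set \<Rightarrow> nat \<Rightarrow> 'a set" where
  "Omega_seq F Om 0 = Om"
| "Omega_seq F Om (Suc n) = closure (F ` Omega_seq F Om n)"

definition attractor :: "('a::euclidean_space \<Rightarrow> 'a) \<Rightarrow> 'a set \<Rightarrow> 'a set" where
  "attractor F Om = (\<Inter>n. Omega_seq F Om n)"

definition finite_type :: "('a::euclidean_space \<Rightarrow> 'a) \<Rightarrow> 'a set \<Rightarrow> bool" where
  "finite_type F Om \<longleftrightarrow> (\<exists>n. Omega_seq F Om n = Omega_seq F Om (Suc n))"

definition trans_lattice :: "(nat \<Rightarrow> 'a::euclidean_space) \<Rightarrow> 'a set" where
  "trans_lattice v = {(\<Sum>i\<in>{1..DIM('a)}. of_int (k i) *\<^sub>R (v i - v 0)) | k. True}"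

text \<open>Ergodicity of the torus rotation R(phi) = phi + pi(v 0) on T = R^d / L with respect
  to Haar measure, expressed through lifts: measurable subsets of T correspond to
  L-periodic Lebesgue measurable subsets of R^d, Haar-null sets to Lebesgue-null lifts,
  and R-invariance (R^-1 B = B) to invariance of the lift under translation by v 0.
  R is ergodic iff every invariant measurable set is null or co-null.\<close>
definition torus_rotation_ergodic :: "(nat \<Rightarrow> 'a::euclidean_space) \<Rightarrow> bool" where
  "torus_rotation_ergodic v \<longleftrightarrow>
     (\<forall>E. E \<in> sets lebesgue \<and>
          (\<forall>l\<in>trans_lattice v. (\<lambda>x. x + l) ` E = E) \<and>
          (\<lambda>x. x + v 0) -` E = E
      \<longrightarrow> E \<in> null_sets lebesgue \<or> (UNIV - E) \<in> null_sets lebesgue)"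

end

theory Submission
  imports Defs
begin

text \<open>
  Let $L$ be the lattice and $D_n = \Omega_n \setminus \Omega_{n+1}$. Since $F(x) - x - v_0 \in L$,
  an open $L$-periodic set $V$ that misses $D_n$ has a translate $V + v_0$ that misses $D_{n+1}$.
  Among all $n$ and all points $\phi$ outside the null set $\bigcup_n \partial\Omega_n + L$, choose a
  pair minimising the number of points of $\Omega_n$ in the fibre $\phi + L$. Near $\phi$ the set
  $\Omega_n$ is a union of full fibre sheets, and by minimality none of them can lose a point at a
  later time. So there is a nonempty open $L$-periodic set $U$ missed by all $D_k$, $k \ge n$. Ergodicity
  makes the rotation minimal, so finitely many translates $U, U + v_0, \dots, U + K v_0$ cover
  the space, and then $D_{n+K} = \emptyset$.
\<close>

section \<open>The lattice: group structure, discreteness, cocompactness\<close>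

lemma trans_latticeI:
  fixes v :: "nat \<Rightarrow> 'a::euclidean_space"
  assumes "x = (\<Sum>i\<in>{1..DIM('a)}. of_int (k i) *\<^sub>R (v i - v 0))"
  shows "x \<in> trans_lattice v"
  unfolding trans_lattice_def using assms by (intro CollectI exI[of _ k]) simp

lemma zero_in_trans_lattice: "0 \<in> trans_lattice v"
  by (rule trans_latticeI[of _ "\<lambda>_. 0"]) simp

lemma add_in_trans_lattice:
  fixes v :: "nat \<Rightarrow> 'a::euclidean_space"
  assumes "x \<in> trans_lattice v" "y \<in> trans_lattice v"
  shows "x + y \<in> trans_lattice v"
proof -
  obtain k l where
    "x = (\<Sum>i\<in>{1..DIM('a)}. of_int (k i) *\<^sub>R (v i - v 0))"
    "y = (\<Sum>i\<in>{1..DIM('a)}. of_int (l i) *\<^sub>R (v i - v 0))"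
    using assms unfolding trans_lattice_def by blast
  then have "x + y = (\<Sum>i\<in>{1..DIM('a)}. of_int (k i + l i) *\<^sub>R (v i - v 0))"
    by (simp add: sum.distrib scaleR_add_left)
  then show ?thesis
    by (rule trans_latticeI)
qed

lemma minus_in_trans_lattice:
  fixes v :: "nat \<Rightarrow> 'a::euclidean_space"
  assumes "x \<in> trans_lattice v"
  shows "- x \<in> trans_lattice v"
proof -
  obtain k where "x = (\<Sum>i\<in>{1..DIM('a)}. of_int (k i) *\<^sub>R (v i - v 0))"
    using assms unfolding trans_lattice_def by blast
  then have "- x = (\<Sum>i\<in>{1..DIM('a)}. of_int (- k i) *\<^sub>R (v i - v 0))"
    by (simp add: sum_negf)
  then show ?thesis
    by (rule trans_latticeI)
qed

lemma diff_in_trans_lattice: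
  "x \<in> trans_lattice v \<Longrightarrow> y \<in> trans_lattice v \<Longrightarrow> x - y \<in> trans_lattice v"
  using add_in_trans_lattice[of x v "- y"] minus_in_trans_lattice[of y v] by simp

text \<open>Including i = 0 makes this apply to every branch: modulo the lattice, each of them moves
  points by \<open>v 0\<close>.\<close>

lemma generator_in_trans_lattice:
  fixes v :: "nat \<Rightarrow> 'a::euclidean_space"
  assumes "i \<le> DIM('a)"
  shows "v i - v 0 \<in> trans_lattice v"
proof (cases "i = 0")
  case True
  then show ?thesis by (simp add: zero_in_trans_lattice)
next
  case False
  have "(\<Sum>j\<in>{1..DIM('a)}. of_int (if j = i then 1 else 0) *\<^sub>R (v j - v 0))
      = (\<Sum>j\<in>{1..DIM('a)}. if j = i then v j - v 0 else 0)"
    by (intro sum.cong) auto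
  also have "\<dots> = v i - v 0"
    using assms False by simp
  finally have "v i - v 0 = (\<Sum>j\<in>{1..DIM('a)}. of_int (if j = i then 1 else 0) *\<^sub>R (v j - v 0))"
    by simp
  then show ?thesis
    by (rule trans_latticeI)
qed

text \<open>As many independent vectors as the dimension form a basis, and linear functionals in
  finite dimension are bounded. Expansion serves cocompactness of the lattice (round the coordinates
  down); uniqueness and the bound serve discreteness (integer coefficients of short vectors are
  bounded).\<close>

lemma coordinates_wrt_full_basis:
  fixes w :: "nat \<Rightarrow> 'a::euclidean_space"
  assumes indep: "independent (w ` {1..DIM('a)})" and inj: "inj_on w {1..DIM('a)}"
  obtains c :: "'a \<Rightarrow> nat \<Rightarrow> real" and B where
    "\<And>x. x = (\<Sum>i\<in>{1..DIM('a)}. c x i *\<^sub>R w i)"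
    "\<And>a i. i \<in> {1..DIM('a)} \<Longrightarrow> c (\<Sum>j\<in>{1..DIM('a)}. a j *\<^sub>R w j) i = a i"
    "\<And>x i. i \<in> {1..DIM('a)} \<Longrightarrow> \<bar>c x i\<bar> \<le> B * norm x"
proof -
  let ?W = "w ` {1..DIM('a)}"
  define c where "c x i = representation ?W x (w i)" for x i
  have "card ?W = DIM('a)"
    using inj by (simp add: card_image)
  then have span: "span ?W = UNIV"
    by (metis dim_UNIV dim_eq_full dim_eq_card_independent indep)
  have lin: "linear (\<lambda>x. c x i)" for i
    unfolding c_def using span indep
    by (intro linearI) (auto simp: representation_add representation_scale)
  have 1: "x = (\<Sum>i\<in>{1..DIM('a)}. c x i *\<^sub>R w i)" for x
  proof -
    have "x = (\<Sum>b\<in>?W. representation ?W x b *\<^sub>R b)"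
      using sum_representation_eq[OF indep, of x ?W] span by simp
    also have "\<dots> = (\<Sum>i\<in>{1..DIM('a)}. c x i *\<^sub>R w i)"
      unfolding c_def using sum.reindex[OF inj] by simp
    finally show ?thesis .
  qed
  have cw: "c (w j) i = (if j = i then 1 else 0)" if "i \<in> {1..DIM('a)}" "j \<in> {1..DIM('a)}" for i j
    unfolding c_def using representation_basis[OF indep, of "w j"] inj that
    by (auto simp del: One_nat_def dest: inj_onD)
  have 2: "c (\<Sum>j\<in>{1..DIM('a)}. a j *\<^sub>R w j) i = a i" if i: "i \<in> {1..DIM('a)}" for a i
  proof -
    have "c (\<Sum>j\<in>{1..DIM('a)}. a j *\<^sub>R w j) i = (\<Sum>j\<in>{1..DIM('a)}. a j * c (w j) i)"
      by (simp only: linear_sum[OF lin] linear_scale[OF lin] real_scaleR_def)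
    also have "\<dots> = (\<Sum>j\<in>{1..DIM('a)}. if j = i then a j else 0)"
      using cw[OF i] by (intro sum.cong refl) simp
    also have "\<dots> = a i"
      using i by simp
    finally show ?thesis .
  qed
  have "\<exists>B. \<forall>x. norm (c x i) \<le> B * norm x" for i
    using linear_bounded[OF lin[of i]] by blast
  then obtain b where b: "\<And>i x. norm (c x i) \<le> b i * norm x"
    by metis
  \<comment> \<open>Summing the bounds of the single coordinates gives one constant for all of
    them.\<close>
  have 3: "\<bar>c x i\<bar> \<le> (\<Sum>i\<in>{1..DIM('a)}. \<bar>b i\<bar>) * norm x" if "i \<in> {1..DIM('a)}" for x i
  proof -
    have "\<bar>b i\<bar> \<le> (\<Sum>i\<in>{1..DIM('a)}. \<bar>b i\<bar>)"
      using that by (intro member_le_sum) auto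
    then have "b i * norm x \<le> (\<Sum>i\<in>{1..DIM('a)}. \<bar>b i\<bar>) * norm x"
      by (intro mult_right_mono) auto
    then show ?thesis
      using b[of x i] by simp
  qed
  show ?thesis
    using that[of c, OF 1 2 3] .
qed

text \<open>A lattice point in a ball has integer coordinates bounded in terms of the radius, so
  there are finitely many. Subtracting the integer parts of the coordinates of x leaves a point of
  the fundamental parallelepiped, which is bounded.\<close>

lemma trans_lattice_discrete_cocompact:
  fixes v :: "nat \<Rightarrow> 'a::euclidean_space"
  assumes indep: "independent ((\<lambda>i. v i - v 0) ` {1..DIM('a)})"
    and inj: "inj_on (\<lambda>i. v i - v 0) {1..DIM('a)}"
  shows "finite (trans_lattice v \<inter> cball 0 r)"
    and "\<exists>R. \<forall>x. \<exists>l\<in>trans_lattice v. norm (x - l) \<le> R"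
proof -
  let ?I = "{1..DIM('a)}" and ?w = "\<lambda>i. v i - v 0"
  obtain c B where
    c1: "\<And>x. x = (\<Sum>i\<in>?I. c x i *\<^sub>R ?w i)" and
    c2: "\<And>a i. i \<in> ?I \<Longrightarrow> c (\<Sum>j\<in>?I. a j *\<^sub>R ?w j) i = a i" and
    c3: "\<And>x i. i \<in> ?I \<Longrightarrow> \<bar>c x i\<bar> \<le> B * norm x"
    using coordinates_wrt_full_basis[OF indep inj] by blast
  define M where "M = \<lceil>\<bar>B\<bar> * \<bar>r\<bar>\<rceil>"
  let ?K = "?I \<rightarrow>\<^sub>E {-M..M}"
  have "trans_lattice v \<inter> cball 0 r \<subseteq> (\<lambda>k. \<Sum>i\<in>?I. of_int (k i) *\<^sub>R ?w i) ` ?K"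
  proof
    fix x assume x: "x \<in> trans_lattice v \<inter> cball 0 r"
    then obtain k where k: "x = (\<Sum>i\<in>?I. of_int (k i) *\<^sub>R ?w i)"
      unfolding trans_lattice_def by blast
    have "k i \<in> {-M..M}" if i: "i \<in> ?I" for i
    proof -
      have "\<bar>real_of_int (k i)\<bar> = \<bar>c x i\<bar>"
        using c2[OF i, of "\<lambda>i. of_int (k i)"] k by simp
      also have "\<dots> \<le> B * norm x"
        by (rule c3[OF i])
      also have "\<dots> \<le> \<bar>B\<bar> * \<bar>r\<bar>"
        using x by (intro mult_mono) auto
      finally have "\<bar>real_of_int (k i)\<bar> \<le> of_int M"
        unfolding M_def by linarith
      then show ?thesis by auto
    qed
    \<comment> \<open>Values of \<open>k\<close> outside the index range are arbitrary; restriction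
      puts \<open>k\<close> into the finite extensional function space without changing the
      sum.\<close>
    then have "restrict k ?I \<in> ?K" by auto
    moreover have "x = (\<Sum>i\<in>?I. of_int (restrict k ?I i) *\<^sub>R ?w i)"
      unfolding k by (intro sum.cong) auto
    ultimately show "x \<in> (\<lambda>k. \<Sum>i\<in>?I. of_int (k i) *\<^sub>R ?w i) ` ?K" by blast
  qed
  moreover have "finite ?K"
    by (intro finite_PiE) auto
  ultimately show "finite (trans_lattice v \<inter> cball 0 r)"
    by (meson finite_imageI finite_subset)
  show "\<exists>R. \<forall>x. \<exists>l\<in>trans_lattice v. norm (x - l) \<le> R"
  proof (intro exI allI)
    fix x
    let ?l = "\<Sum>i\<in>?I. of_int \<lfloor>c x i\<rfloor> *\<^sub>R ?w i"
    have "x - ?l = (\<Sum>i\<in>?I. (c x i - of_int \<lfloor>c x i\<rfloor>) *\<^sub>R ?w i)"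
      by (subst c1[of x]) (simp only: sum_subtractf scaleR_diff_left)
    also have "norm \<dots> \<le> (\<Sum>i\<in>?I. norm (?w i))"
    proof (intro sum_norm_le)
      fix i
      have "\<bar>c x i - of_int \<lfloor>c x i\<rfloor>\<bar> \<le> 1" by linarith
      then show "norm ((c x i - of_int \<lfloor>c x i\<rfloor>) *\<^sub>R ?w i) \<le> norm (?w i)"
        by (simp add: mult_left_le_one_le)
    qed
    finally have "norm (x - ?l) \<le> (\<Sum>i\<in>?I. norm (?w i))" .
    moreover have "?l \<in> trans_lattice v"
      by (rule trans_latticeI) (rule refl)
    ultimately show "\<exists>l\<in>trans_lattice v. norm (x - l) \<le> (\<Sum>i\<in>?I. norm (?w i))" by blast
  qed
qed

section \<open>Stabilisation of decreasing compact sets on fibres\<close>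

lemma countable_if_finite_in_balls:
  fixes L :: "'a::real_normed_vector set"
  assumes "\<And>r. finite (L \<inter> cball 0 r)"
  shows "countable L"
proof -
  have "L = (\<Union>n::nat. L \<inter> cball 0 (real n))"
    by (auto simp: real_arch_simple)
  moreover have "countable (\<Union>n::nat. L \<inter> cball 0 (real n))"
    using assms by (intro countable_UN) (auto intro: countable_finite)
  ultimately show ?thesis by simp
qed

lemma eventually_locally_constant_membership:
  assumes "x \<notin> frontier S"
  shows "\<forall>\<^sub>F y in nhds x. y \<in> S \<longleftrightarrow> x \<in> S"
proof (cases "x \<in> S")
  case True
  then have "x \<in> interior S"
    using assms closure_subset by (auto simp: frontier_def)
  then have "\<forall>\<^sub>F y in nhds x. y \<in> interior S"
    by (intro eventually_nhds_in_open) auto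
  then show ?thesis
    by (rule eventually_mono) (use True interior_subset in auto)
next
  case False
  then have "x \<in> - closure S"
    using assms interior_subset by (auto simp: frontier_def)
  then have "\<forall>\<^sub>F y in nhds x. y \<in> - closure S"
    by (intro eventually_nhds_in_open) auto
  then show ?thesis
    by (rule eventually_mono) (use False closure_subset in auto)
qed

text \<open>Minimality of the fibre count compares only points outside \<open>bad\<close>.
  Closedness of \<open>X k\<close> then extends the conclusion to all of \<open>U\<close>: a sheet
  that loses one point over \<open>U\<close> loses an open set of points, and this contains a point
  outside \<open>bad\<close>.\<close>

lemma decseq_compact_stabilizes_on_fibres:
  fixes X :: "nat \<Rightarrow> 'a::euclidean_space set"
  assumes L: "\<And>r. finite (L \<inter> cball 0 r)"
    and dec: "decseq X"
    and comp: "\<And>n. compact (X n)"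
    and fr: "\<And>n. negligible (frontier (X n))"
  obtains n U where "open U" "U \<noteq> {}"
    "\<And>k y l. k \<ge> n \<Longrightarrow> y \<in> U \<Longrightarrow> l \<in> L \<Longrightarrow> y + l \<in> X n \<Longrightarrow> y + l \<in> X k"
proof -
  \<comment> \<open>The base points whose fibre meets some frontier; since \<open>L\<close> is
    countable, they form a null set.\<close>
  define bad where "bad = (\<Union>l\<in>L. \<Union>n. (+) (- l) ` frontier (X n))"
  have "negligible bad"
    unfolding bad_def
    by (intro negligible_countable_Union countable_image countable_if_finite_in_balls[OF L])
       (auto simp del: uminus_add_conv_diff
          intro!: negligible_countable_Union negligible_translation fr)
  then have good: "\<exists>y\<in>S. y \<notin> bad" if "open S" "S \<noteq> {}" for S
    using that open_not_negligible negligible_subset by (metis subsetI)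
  have not_bad: "y + l \<notin> frontier (X n)" if "y \<notin> bad" "l \<in> L" for y l n
    using that unfolding bad_def by (force simp: image_iff)
  define S where "S n y = {l\<in>L. y + l \<in> X n}" for n y
  obtain B where B: "\<And>x. x \<in> X 0 \<Longrightarrow> norm x \<le> B"
    using compact_imp_bounded[OF comp[of 0]] unfolding bounded_iff by auto
  have X0: "X n \<subseteq> X 0" for n
    using dec by (simp add: decseq_def)
  have S_sub: "S n y \<subseteq> L \<inter> cball 0 (B + norm y)" for n y
  proof
    fix l assume "l \<in> S n y"
    then have "l \<in> L" "norm (y + l) \<le> B"
      using X0 B by (auto simp: S_def)
    moreover have "norm l \<le> norm (y + l) + norm y"
      using norm_triangle_ineq4[of "y + l" y] by simp
    ultimately show "l \<in> L \<inter> cball 0 (B + norm y)" by simp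
  qed
  then have S_fin: "finite (S n y)" for n y
    using L finite_subset by blast
  obtain y0 where "y0 \<notin> bad"
    using good[of UNIV] by auto
  then have "\<exists>N n y. y \<notin> bad \<and> card (S n y) = N" by blast
  then obtain N where N: "\<exists>n y. y \<notin> bad \<and> card (S n y) = N"
    and N_min: "\<And>M. M < N \<Longrightarrow> \<not> (\<exists>n y. y \<notin> bad \<and> card (S n y) = M)"
    using exists_least_iff[of "\<lambda>N. \<exists>n y. y \<notin> bad \<and> card (S n y) = N"] by blast
  obtain n \<phi> where \<phi>: "\<phi> \<notin> bad" "card (S n \<phi>) = N"
    using N by blast
  have N_le: "N \<le> card (S k y)" if "y \<notin> bad" for k y
    using N_min[of "card (S k y)"] that by (metis not_le)
  \<comment> \<open>One finite set containing \<open>S n y\<close> for every y within distance 1 of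
    \<phi>, so that only finitely many local constancy statements must hold simultaneously.\<close>
  let ?Lf = "L \<inter> cball 0 (B + norm \<phi> + 1)"
  have "\<forall>\<^sub>F y in nhds \<phi>. y + l \<in> X n \<longleftrightarrow> \<phi> + l \<in> X n" if "l \<in> L" for l
  proof -
    have "((\<lambda>y. y + l) \<longlongrightarrow> \<phi> + l) (nhds \<phi>)"
      by (intro tendsto_add tendsto_const filterlim_ident)
    then show ?thesis
      using eventually_locally_constant_membership[OF not_bad[OF \<phi>(1) that]]
      by (rule filterlim_iff[THEN iffD1, rule_format])
  qed
  then have "\<forall>\<^sub>F y in nhds \<phi>. \<forall>l\<in>?Lf. y + l \<in> X n \<longleftrightarrow> \<phi> + l \<in> X n"
    by (intro eventually_ball_finite L) auto
  moreover have "\<forall>\<^sub>F y in nhds \<phi>. y \<in> ball \<phi> 1"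
    by (intro eventually_nhds_in_open) auto
  ultimately have "\<forall>\<^sub>F y in nhds \<phi>. S n y = S n \<phi>"
  proof eventually_elim
    case (elim y)
    have "norm y \<le> norm \<phi> + 1"
      using elim(2) norm_triangle_ineq2[of y \<phi>] by (simp add: dist_norm norm_minus_commute)
    then have "S n y \<subseteq> ?Lf" "S n \<phi> \<subseteq> ?Lf"
      using S_sub[of n y] S_sub[of n \<phi>] by (auto simp: subset_iff)
    then show ?case
      using elim(1) unfolding S_def by blast
  qed
  then obtain U where U: "open U" "\<phi> \<in> U" "\<And>y. y \<in> U \<Longrightarrow> S n y = S n \<phi>"
    unfolding eventually_nhds by blast
  \<comment> \<open>Since \<open>X\<close> decreases, the later fibre is contained in
    \<open>S n y\<close>, which is \<open>S n \<phi>\<close>; it has at least \<open>N\<close>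
    elements by minimality, and \<open>S n \<phi>\<close> has exactly \<open>N\<close>.\<close>
  have good_in: "S k y = S n \<phi>" if "k \<ge> n" "y \<in> U" "y \<notin> bad" for k y
  proof -
    have "S k y \<subseteq> S n \<phi>"
      using dec that U(3)[of y] unfolding S_def decseq_def by blast
    then show ?thesis
      using card_seteq[OF S_fin] N_le[OF that(3)] \<phi>(2) by simp
  qed
  show thesis
  proof (rule that[of U n])
    show "open U" "U \<noteq> {}" using U by auto
    fix k y l assume *: "k \<ge> n" "y \<in> U" "l \<in> L" "y + l \<in> X n"
    show "y + l \<in> X k"
    proof (rule ccontr)
      assume "y + l \<notin> X k"
      let ?V = "U \<inter> (\<lambda>y. y + l) -` (- X k)"
      have "open ?V"
        using U(1) comp[of k] compact_imp_closed
        by (intro open_Int open_vimage) (auto intro!: continuous_intros)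
      moreover have "y \<in> ?V"
        using * \<open>y + l \<notin> X k\<close> by simp
      ultimately obtain z where z: "z \<in> ?V" "z \<notin> bad"
        using good[of ?V] by blast
      have "l \<in> S n \<phi>"
        using * U(3)[of y] by (auto simp: S_def)
      then have "l \<in> S k z"
        using good_in[of k z] z * by simp
      then show False
        using z by (simp add: S_def)
    qed
  qed
qed

section \<open>Covering the space by translates of an open set\<close>

text \<open>
  Ergodicity only says that the translates of $U$ cover almost everything; applied to a smaller
  ball, with the difference of radii absorbing the error, it yields every point.
\<close>
lemma ergodic_translates_cover:
  fixes v :: "nat \<Rightarrow> 'a::euclidean_space"
  assumes erg: "torus_rotation_ergodic v" and U: "open U" "U \<noteq> {}"
  shows "\<exists>k::int. \<exists>l\<in>trans_lattice v. x + of_int k *\<^sub>R v 0 + l \<in> U"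
proof -
  let ?L = "trans_lattice v"
  obtain u r where r: "r > 0" "ball u (2 * r) \<subseteq> U"
  proof -
    obtain u where "u \<in> U" using U by blast
    then obtain e where "e > 0" "ball u e \<subseteq> U"
      using U openE by blast
    then show ?thesis using that[of "e / 2" u] by simp
  qed
  \<comment> \<open>The lift of the two-sided orbit of a ball under the rotation: allowing negative
    \<open>k\<close> makes \<open>E\<close> exactly invariant, as the ergodicity hypothesis
    requires, and not merely mapped into itself.\<close>
  define E where "E = {y. \<exists>k::int. \<exists>l\<in>?L. y + of_int k *\<^sub>R v 0 + l \<in> ball u r}"
  have "E = (\<Union>k::int. \<Union>l\<in>?L. (\<lambda>y. y + of_int k *\<^sub>R v 0 + l) -` ball u r)"
    unfolding E_def by blast
  moreover have "open ((\<lambda>y. y + of_int k *\<^sub>R v 0 + l) -` ball u r)" for k l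
    by (intro open_vimage) (auto intro!: continuous_intros)
  ultimately have "open E" by auto
  then have meas: "E \<in> sets lebesgue"
    by (simp add: borel_open sets_completionI_sets)
  have addL: "y + l \<in> E" if "y \<in> E" "l \<in> ?L" for y l
  proof -
    obtain k m where "m \<in> ?L" "y + of_int k *\<^sub>R v 0 + m \<in> ball u r"
      using \<open>y \<in> E\<close> unfolding E_def by blast
    moreover have "y + of_int k *\<^sub>R v 0 + m = y + l + of_int k *\<^sub>R v 0 + (m - l)" by simp
    ultimately show ?thesis
      unfolding E_def using diff_in_trans_lattice[OF _ \<open>l \<in> ?L\<close>] by (metis (mono_tags, lifting) mem_Collect_eq)
  qed
  have "(\<lambda>x. x + l) ` E = E" if l: "l \<in> ?L" for l
  proof
    show "(\<lambda>x. x + l) ` E \<subseteq> E" using addL l by blast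
    show "E \<subseteq> (\<lambda>x. x + l) ` E"
    proof
      fix y assume "y \<in> E"
      then have "y + - l \<in> E" using addL minus_in_trans_lattice[OF l] by blast
      then show "y \<in> (\<lambda>x. x + l) ` E" by (force simp: image_iff)
    qed
  qed
  moreover have "(\<lambda>x. x + v 0) -` E = E"
  proof -
    have shift: "y + of_int j *\<^sub>R v 0 \<in> E" if "y \<in> E" for y and j :: int
    proof -
      obtain k m where "m \<in> ?L" "y + of_int k *\<^sub>R v 0 + m \<in> ball u r"
        using \<open>y \<in> E\<close> unfolding E_def by blast
      moreover have "y + of_int k *\<^sub>R v 0 + m = y + of_int j *\<^sub>R v 0 + of_int (k - j) *\<^sub>R v 0 + m"
        by (simp add: scaleR_diff_left)
      ultimately show ?thesis
        unfolding E_def by (metis (mono_tags, lifting) mem_Collect_eq)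
    qed
    have "y + v 0 \<in> E \<longleftrightarrow> y \<in> E" for y
      using shift[of y 1] shift[of "y + v 0" "-1"] by auto
    then show ?thesis by auto
  qed
  ultimately have "E \<in> null_sets lebesgue \<or> UNIV - E \<in> null_sets lebesgue"
    using meas by (intro erg[unfolded torus_rotation_ergodic_def, rule_format]) simp
  moreover have "u \<in> E"
    unfolding E_def using r zero_in_trans_lattice[of v]
    by (intro CollectI exI[of _ 0] bexI[of _ 0]) auto
  then have "E \<notin> null_sets lebesgue"
    using open_not_negligible[OF \<open>open E\<close>] negligible_iff_null_sets by blast
  ultimately have "negligible (UNIV - E)"
    by (simp add: negligible_iff_null_sets)
  then have "\<not> ball x r \<subseteq> UNIV - E"
    using r open_not_negligible[of "ball x r"] negligible_subset by (metis centre_in_ball empty_iff open_ball)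
  then obtain y where y: "y \<in> ball x r" "y \<in> E" by blast
  then obtain k l where kl: "l \<in> ?L" "y + of_int k *\<^sub>R v 0 + l \<in> ball u r"
    unfolding E_def by blast
  have "dist u (x + of_int k *\<^sub>R v 0 + l)
      \<le> dist u (y + of_int k *\<^sub>R v 0 + l) + dist (y + of_int k *\<^sub>R v 0 + l) (x + of_int k *\<^sub>R v 0 + l)"
    by (rule dist_triangle)
  also have "\<dots> < r + r"
    using kl(2) y(1) by (intro add_strict_mono) (auto simp: dist_commute)
  finally show ?thesis
    using r kl(1) by (intro exI[of _ k] bexI[of _ l]) auto
qed

text \<open>Modulo the lattice every point lies in a fixed closed ball, and compactness of that ball
  leaves finitely many integer shifts. They may have both signs, whereas the shifts are later
  matched with steps in time, so they are moved to one side.\<close>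

lemma ergodic_finitely_many_translates_cover:
  fixes v :: "nat \<Rightarrow> 'a::euclidean_space"
  assumes erg: "torus_rotation_ergodic v" and U: "open U" "U \<noteq> {}"
    and indep: "independent ((\<lambda>i. v i - v 0) ` {1..DIM('a)})"
    and inj: "inj_on (\<lambda>i. v i - v 0) {1..DIM('a)}"
  obtains K where "\<And>x. \<exists>i\<le>K. \<exists>l\<in>trans_lattice v. x - real i *\<^sub>R v 0 + l \<in> U"
proof -
  let ?L = "trans_lattice v"
  obtain R where R: "\<And>x. \<exists>l\<in>?L. norm (x - l) \<le> R"
    using trans_lattice_discrete_cocompact(2)[OF indep inj] by blast
  define W where "W k = (\<Union>l\<in>?L. (\<lambda>y. y + of_int k *\<^sub>R v 0 + l) -` U)" for k :: int
  have "open (W k)" for k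
    unfolding W_def using U(1)
    by (intro open_UN ballI open_vimage) (auto intro!: continuous_intros)
  moreover have "cball 0 R \<subseteq> (\<Union>k. W k)"
    using ergodic_translates_cover[OF erg U] by (auto simp: W_def)
  ultimately obtain J where J: "finite J" "cball 0 R \<subseteq> (\<Union>k\<in>J. W k)"
    using compactE_image[OF compact_cball, of UNIV W 0 R] by (metis subset_UNIV)
  obtain m where m: "\<And>k. k \<in> J \<Longrightarrow> \<bar>k\<bar> \<le> m"
  proof
    fix k assume "k \<in> J"
    then show "\<bar>k\<bar> \<le> (\<Sum>k\<in>J. \<bar>k\<bar>)"
      using J(1) by (intro member_le_sum) auto
  qed
  have "\<exists>i\<le>nat (2 * m). \<exists>l\<in>?L. x - real i *\<^sub>R v 0 + l \<in> U" for x
  proof -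
    \<comment> \<open>Covering x - m v_0 instead of x turns the shift by k into one by k - m; as |k|
      \<le> m, the number m - k lies between 0 and 2m.\<close>
    obtain l1 where l1: "l1 \<in> ?L" "norm (x - of_int m *\<^sub>R v 0 - l1) \<le> R"
      using R by blast
    then obtain k where k: "k \<in> J" "x - of_int m *\<^sub>R v 0 - l1 \<in> W k"
      using J(2) by (auto simp: subset_iff)
    then obtain l2 where l2: "l2 \<in> ?L" "x - of_int m *\<^sub>R v 0 - l1 + of_int k *\<^sub>R v 0 + l2 \<in> U"
      unfolding W_def by blast
    have i: "real (nat (m - k)) = of_int m - of_int k" "nat (m - k) \<le> nat (2 * m)"
      using m[OF k(1)] by auto
    have "x - of_int m *\<^sub>R v 0 - l1 + of_int k *\<^sub>R v 0 + l2
        = x - real (nat (m - k)) *\<^sub>R v 0 + (l2 - l1)"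
      unfolding i(1) by (simp add: scaleR_diff_left)
    then show ?thesis
      using l2 i(2) diff_in_trans_lattice[OF l2(1) l1(1)] by metis
  qed
  then show ?thesis using that by blast
qed

section \<open>The sets \<Omega>_n: monotonicity, lost points, null frontiers\<close>

lemma decseq_Omega_seq:
  assumes "F ` Om \<subseteq> Om" "closed Om"
  shows "decseq (Omega_seq F Om)"
proof -
  have "Omega_seq F Om (Suc n) \<subseteq> Omega_seq F Om n" for n
  proof (induction n)
    case 0
    then show ?case using assms by (simp add: closure_minimal)
  next
    case (Suc n)
    then have "closure (F ` Omega_seq F Om (Suc n)) \<subseteq> closure (F ` Omega_seq F Om n)"
      by (intro closure_mono image_mono)
    then show ?case by simp
  qed
  then show ?thesis by (intro decseq_SucI)
qed

text \<open>A limit of images of points of \<Omega>_n that is not a limit of images of points of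
  \<Omega>_(n+1) must be a limit of images of the points lost in between, because closure commutes
  with binary unions.\<close>

lemma Omega_seq_diff_Suc_subset:
  "Omega_seq F Om (Suc n) - Omega_seq F Om (Suc (Suc n))
    \<subseteq> closure (F ` (Omega_seq F Om n - Omega_seq F Om (Suc n)))"
proof -
  let ?X = "Omega_seq F Om"
  have "F ` ?X n \<subseteq> F ` (?X n - ?X (Suc n)) \<union> F ` ?X (Suc n)" by blast
  then have "closure (F ` ?X n) \<subseteq> closure (F ` (?X n - ?X (Suc n))) \<union> closure (F ` ?X (Suc n))"
    by (metis closure_Un closure_mono)
  then show ?thesis by auto
qed

lemma Omega_seq_eq_attractor:
  assumes dec: "decseq (Omega_seq F Om)"
    and eq: "Omega_seq F Om n = Omega_seq F Om (Suc n)" and "k \<ge> n"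
  shows "Omega_seq F Om k = attractor F Om"
proof -
  have const: "Omega_seq F Om j = Omega_seq F Om n" if "j \<ge> n" for j
    using that
  proof (induction j rule: dec_induct)
    case (step j)
    then have "Omega_seq F Om (Suc j) = Omega_seq F Om (Suc n)" by simp
    then show ?case by (rule trans[OF _ eq[symmetric]])
  qed simp
  have "Omega_seq F Om n \<subseteq> Omega_seq F Om j" for j
    using const[of j] dec by (cases "j \<ge> n") (auto simp: decseq_def)
  then show ?thesis
    using const[OF \<open>k \<ge> n\<close>] unfolding attractor_def by blast
qed

text \<open>The map translates each set \<open>?X \<inter> Q i\<close>, where \<open>Q i\<close> is
  the part of the domain with index i. Cutting by \<open>Q i\<close> adds only points of
  \<open>frontier (P i)\<close> to the frontier, and translations, finite unions and closure keep
  frontiers null.\<close>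

lemma negligible_frontier_Omega_seq:
  fixes Om :: "'a::euclidean_space set"
  assumes pt: "piecewise_translation m Om P v idx"
  shows "negligible (frontier (Omega_seq (pt_map v idx) Om n))"
proof (induction n)
  have Om: "Om = (\<Union>i<m. P i)" and P: "\<And>i. i < m \<Longrightarrow> negligible (frontier (P i))"
    using pt by (auto simp: piecewise_translation_def negligible_iff_null_sets)
  {
    case 0
    have "frontier Om \<subseteq> (\<Union>i<m. frontier (P i))"
      unfolding Om using frontier_Union_subset[of "P ` {..<m}"] by auto
    moreover have "negligible (\<Union>i<m. frontier (P i))"
      using P by (intro negligible_Union) auto
    ultimately show ?case
      using negligible_subset by auto
  }
  case (Suc n)
  let ?X = "Omega_seq (pt_map v idx) Om n"
  define Q where "Q i = {x\<in>Om. idx x = i}" for i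
  have comp: "compact Om" and compP: "\<And>i. i < m \<Longrightarrow> compact (P i)"
    and disj: "\<And>i j. i < m \<Longrightarrow> j < m \<Longrightarrow> i \<noteq> j \<Longrightarrow> P i \<inter> P j \<subseteq> frontier (P i)"
    and idx: "\<And>x. x \<in> Om \<Longrightarrow> idx x < m \<and> x \<in> P (idx x)"
    and inv: "\<And>i x. i < m \<Longrightarrow> x \<in> P i \<Longrightarrow> x + v i \<in> Om"
    using pt unfolding piecewise_translation_def region_def by auto
  have "decseq (Omega_seq (pt_map v idx) Om)"
    using idx inv comp by (intro decseq_Omega_seq) (auto simp: pt_map_def compact_imp_closed)
  then have sub: "?X \<subseteq> Om"
    unfolding decseq_def by (metis Omega_seq.simps(1) le0)
  have frQ: "frontier (Q i) \<subseteq> frontier (P i)" if i: "i < m" for i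
  proof -
    have "closure (Q i) \<subseteq> P i"
      using idx compP[OF i] by (intro closure_minimal) (auto simp: Q_def compact_imp_closed)
    \<comment> \<open>An interior point of \<open>P i\<close> is off its frontier, hence in no other
      piece, so the index rule has no choice there.\<close>
    moreover have "interior (P i) \<subseteq> Q i"
    proof
      fix x assume x: "x \<in> interior (P i)"
      then have "x \<in> P i" using interior_subset by blast
      then have "x \<in> Om" using Om i by blast
      moreover have "idx x = i"
        using disj[of i "idx x"] idx[OF \<open>x \<in> Om\<close>] i x \<open>x \<in> P i\<close> by (auto simp: frontier_def)
      ultimately show "x \<in> Q i" by (simp add: Q_def)
    qed
    then have "interior (P i) \<subseteq> interior (Q i)"
      by (simp add: interior_maximal)
    ultimately show ?thesis
      using closure_subset[of "P i"] by (auto simp: frontier_def)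
  qed
  have eq: "pt_map v idx ` ?X = (\<Union>i<m. (+) (v i) ` (?X \<inter> Q i))"
    using sub idx by (force simp: Q_def pt_map_def image_iff add.commute)
  have neg: "negligible (frontier ((+) (v i) ` (?X \<inter> Q i)))" if "i < m" for i
  proof -
    have "frontier (?X \<inter> Q i) \<subseteq> frontier ?X \<union> frontier (P i)"
      using frontier_Int_subset[of ?X "Q i"] frQ[OF that] by blast
    then have "negligible (frontier (?X \<inter> Q i))"
      using Suc P[OF that] negligible_Un negligible_subset by blast
    then show ?thesis
      by (simp add: frontier_translation negligible_translation)
  qed
  \<comment> \<open>Taking the closure of a set leaves its closure unchanged and can only enlarge
    its interior.\<close>
  have "frontier (closure (pt_map v idx ` ?X)) \<subseteq> frontier (pt_map v idx ` ?X)"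
    unfolding frontier_def closure_closure
    by (intro Diff_mono interior_mono closure_subset subset_refl)
  also have "\<dots> \<subseteq> (\<Union>i<m. frontier ((+) (v i) ` (?X \<inter> Q i)))"
    unfolding eq using frontier_Union_subset[of "(\<lambda>i. (+) (v i) ` (?X \<inter> Q i)) ` {..<m}"] by auto
  finally have "frontier (closure (pt_map v idx ` ?X)) \<subseteq> (\<Union>i<m. frontier ((+) (v i) ` (?X \<inter> Q i)))" .
  moreover have "negligible (\<Union>i<m. frontier ((+) (v i) ` (?X \<inter> Q i)))"
    using neg by (intro negligible_Union) auto
  ultimately show ?case
    using negligible_subset by auto
qed

section \<open>Propagating the missed open set along the rotation\<close>

theorem theorem2p1:
  fixes Om :: "'a::euclidean_space set"
    and P :: "nat \<Rightarrow> 'a set"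
    and v :: "nat \<Rightarrow> 'a"
    and idx :: "'a \<Rightarrow> nat"
  assumes pt: "piecewise_translation (DIM('a) + 1) Om P v idx"
    and indep: "independent ((\<lambda>i. v i - v 0) ` {1..DIM('a)})"
    and inj: "inj_on (\<lambda>i. v i - v 0) {1..DIM('a)}"
    and erg: "torus_rotation_ergodic v"
  shows "finite_type (pt_map v idx) Om \<and>
    (\<exists>n. Omega_seq (pt_map v idx) Om n = Omega_seq (pt_map v idx) Om (Suc n) \<and>
         (\<forall>k\<ge>n. Omega_seq (pt_map v idx) Om k = attractor (pt_map v idx) Om))"
proof -
  let ?L = "trans_lattice v" and ?F = "pt_map v idx"
  let ?X = "Omega_seq ?F Om"
  define D where "D n = ?X n - ?X (Suc n)" for n
  have comp: "compact Om"
    and idx: "\<And>x. x \<in> Om \<Longrightarrow> idx x \<le> DIM('a) \<and> x \<in> P (idx x)"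
    and inv: "\<And>i x. i \<le> DIM('a) \<Longrightarrow> x \<in> P i \<Longrightarrow> x + v i \<in> Om"
    using pt unfolding piecewise_translation_def region_def by (auto simp: less_Suc_eq_le)
  have dec: "decseq ?X"
    using idx inv comp by (intro decseq_Omega_seq) (auto simp: pt_map_def compact_imp_closed)
  have sub: "?X n \<subseteq> Om" for n
    using dec unfolding decseq_def by (metis Omega_seq.simps(1) le0)
  have "closed (?X n)" for n
    using comp by (cases n) (auto simp: compact_imp_closed)
  then have compX: "compact (?X n)" for n
    using compact_Int_closed[OF comp] sub[of n] by (metis inf.absorb2)
  obtain n U where U: "open U" "U \<noteq> {}"
    and stable: "\<And>k y l. k \<ge> n \<Longrightarrow> y \<in> U \<Longrightarrow> l \<in> ?L \<Longrightarrow> y + l \<in> ?X n \<Longrightarrow> y + l \<in> ?X k"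
    by (rule decseq_compact_stabilizes_on_fibres[OF trans_lattice_discrete_cocompact(1)[OF indep inj]
        dec compX negligible_frontier_Omega_seq[OF pt]]) blast
  \<comment> \<open>The lift of the i-th rotate of \<open>U\<close>, that is U + i v_0 + L.\<close>
  define V where "V i = (\<Union>l\<in>?L. (\<lambda>x. x - real i *\<^sub>R v 0 + l) -` U)" for i :: nat
  have openV: "open (V i)" for i
    unfolding V_def using U(1)
    by (intro open_UN ballI open_vimage) (auto intro!: continuous_intros)
  obtain K where K: "\<And>x. \<exists>i\<le>K. x \<in> V i"
    using ergodic_finitely_many_translates_cover[OF erg U indep inj] unfolding V_def
    by (metis UN_iff vimage_eq)
  \<comment> \<open>Every starting time k from n on is allowed, so that later a single D_(n+K) can
    be tested against all V_i with i \<le> K.\<close>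
  have D_V: "D (k + i) \<inter> V i = {}" if "k \<ge> n" for k i
  proof (induction i)
    case 0
    have "x \<notin> D k" if "x \<in> V 0" for x
    proof
      assume x: "x \<in> D k"
      obtain l where l: "l \<in> ?L" "x + l \<in> U"
        using \<open>x \<in> V 0\<close> by (auto simp: V_def)
      have "x \<in> ?X n"
        using x dec \<open>k \<ge> n\<close> unfolding D_def decseq_def by blast
      then have "x \<in> ?X (Suc k)"
        \<comment> \<open>The fibre is based at \<open>x + l\<close>, which lies in
          \<open>U\<close>; the lattice vector \<open>- l\<close> leads back to
          \<open>x\<close>.\<close>
        using stable[of "Suc k" "x + l" "- l"] l minus_in_trans_lattice[OF l(1)] \<open>k \<ge> n\<close> by simp
      then show False using x by (simp add: D_def)
    qed
    then show ?case by auto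
  next
    case (Suc i)
    have "?F x \<notin> V (Suc i)" if x: "x \<in> D (k + i)" for x
    proof
      assume "?F x \<in> V (Suc i)"
      then obtain l where l: "l \<in> ?L" "?F x - real (Suc i) *\<^sub>R v 0 + l \<in> U"
        unfolding V_def by blast
      \<comment> \<open>This is the semiconjugacy of the map to the rotation: \<open>?F x\<close>
        and x + v_0 differ by a lattice vector.\<close>
      have "?F x - real (Suc i) *\<^sub>R v 0 + l = x - real i *\<^sub>R v 0 + ((v (idx x) - v 0) + l)"
        by (simp add: pt_map_def scaleR_add_left)
      moreover have "x \<in> Om"
        using x sub by (auto simp: D_def)
      then have "(v (idx x) - v 0) + l \<in> ?L"
        using generator_in_trans_lattice idx l(1) by (intro add_in_trans_lattice) auto
      ultimately have "x \<in> V i"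
        using l(2) unfolding V_def by (metis UN_I vimageI2)
      then show False using Suc x by blast
    qed
    \<comment> \<open>An open set that misses a set misses its closure, and the closure contains the
      next difference set.\<close>
    then have "V (Suc i) \<inter> closure (?F ` D (k + i)) = {}"
      using openV by (subst open_Int_closure_eq_empty) auto
    then show ?case
      using Omega_seq_diff_Suc_subset[of ?F Om "k + i"] unfolding D_def by auto
  qed
  have "x \<notin> D (n + K)" for x
  proof -
    obtain i where "i \<le> K" "x \<in> V i" using K by blast
    then show ?thesis
      \<comment> \<open>For x in V_i, write n + K as (n + (K - i)) + i.\<close>
      using D_V[OF le_add1, of "K - i" i] by auto
  qed
  then have "?X (n + K) = ?X (Suc (n + K))"
    using dec unfolding D_def decseq_def by (metis Diff_iff le_SucI order_refl subsetI subset_antisym)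
  then show ?thesis
    using Omega_seq_eq_attractor[OF dec] unfolding finite_type_def by blast
qed

end
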